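(* Let $a,b,c\in\mathbb{C}$ and let the contour $[0,1]\ni s\mapsto\gamma(s)$ satisfy $$t^{b-c+1}(1-t)^{c-a}(t-z)^{-b-1}\Big|_{t=\gamma(0)}^{t=\gamma(1)}=0.$$ Then $$\mathcal{F}(a,b;c;z,\partial_z)\int_\gamma t^{b-c}(1-t)^{c-a-1}(t-z)^{-b}\,dt=0.$$
   Context: The hypergeometric (${}_2F_1$) operator is $\mathcal{F}(a,b;c;z,\partial_z):=z(1-z)\partial_z^2+\big(c-(a+b+1)z\big)\partial_z-ab$, where $z$ is a complex variable. Notation: $f(t)\big|_{t=\gamma(0)}^{t=\gamma(1)}:=f(\gamma(1))-f(\gamma(0))$, which for a curve $\gamma$ equals $\int_\gamma f'(t)\,dt$. Power functions are the principal branches $w^\mu=e^{\mu\log w}$, extended where needed by analytic continuation to the appropriate covering of $\mathbb{C}\setminus\{0\}$. *)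

theory Defs
  imports "HOL-Complex_Analysis.Complex_Analysis"
begin

definition hypergeometric_op ::
    "complex \<Rightarrow> complex \<Rightarrow> complex \<Rightarrow> (complex \<Rightarrow> complex) \<Rightarrow> complex \<Rightarrow> complex" where
  "hypergeometric_op a b c f z =
     z * (1 - z) * (deriv ^^ 2) f z + (c - (a + b + 1) * z) * deriv f z - a * b * f z"

text \<open>
  The powers of \<open>t\<close>, \<open>1 - t\<close> and \<open>t - z\<close> live on a covering of the punctured plane. A lift of
  the contour to that covering is given by continuous logarithms along the contour,
  and \<open>w powr \<mu>\<close> is then read as \<open>exp (\<mu> * L)\<close>, with the same \<open>L\<close> for all exponents \<open>\<mu>\<close>.
  Self-intersecting contours may thus carry different branches at the same point. In a
  region where \<open>Ln\<close> is continuous, \<open>L = Ln \<circ> w\<close> gives the principal power.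
\<close>
definition log_branch_on ::
    "'a::topological_space set \<Rightarrow> ('a \<Rightarrow> complex) \<Rightarrow> ('a \<Rightarrow> complex) \<Rightarrow> bool" where
  "log_branch_on S L w \<longleftrightarrow> continuous_on S L \<and> (\<forall>x\<in>S. exp (L x) = w x)"

text \<open>
  \<open>L0\<close>, \<open>L1\<close>, \<open>L2 z\<close> are logarithms of \<open>t\<close>, \<open>1 - t\<close>, \<open>t - z\<close> along \<open>t = \<gamma> s\<close>. The first function
  is \<open>t powr (b - c) * (1 - t) powr (c - a - 1) * (t - z) powr (- b)\<close>, the second is
  \<open>t powr (b - c + 1) * (1 - t) powr (c - a) * (t - z) powr (- b - 1)\<close>.
\<close>
definition euler_integrand ::
    "complex \<Rightarrow> complex \<Rightarrow> complex \<Rightarrow> (real \<Rightarrow> complex) \<Rightarrow> (real \<Rightarrow> complex) \<Rightarrow>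
     (complex \<Rightarrow> real \<Rightarrow> complex) \<Rightarrow> complex \<Rightarrow> real \<Rightarrow> complex" where
  "euler_integrand a b c L0 L1 L2 z s =
     exp ((b - c) * L0 s) * exp ((c - a - 1) * L1 s) * exp (- b * L2 z s)"

definition boundary_term ::
    "complex \<Rightarrow> complex \<Rightarrow> complex \<Rightarrow> (real \<Rightarrow> complex) \<Rightarrow> (real \<Rightarrow> complex) \<Rightarrow>
     (complex \<Rightarrow> real \<Rightarrow> complex) \<Rightarrow> complex \<Rightarrow> real \<Rightarrow> complex" where
  "boundary_term a b c L0 L1 L2 z s =
     exp ((b - c + 1) * L0 s) * exp ((c - a) * L1 s) * exp ((- b - 1) * L2 z s)"

text \<open>
  The integrand is multivalued in \<open>t\<close>, so \<open>contour_integral\<close> does not apply; this is what it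
  unfolds to, with the integrand given as a function of the parameter.
\<close>
definition integral_along :: "(real \<Rightarrow> complex) \<Rightarrow> (real \<Rightarrow> complex) \<Rightarrow> complex" where
  "integral_along \<gamma> f =
     integral {0..1} (\<lambda>s. f s * vector_derivative \<gamma> (at s within {0..1}))"

definition abs_integrable_along :: "(real \<Rightarrow> complex) \<Rightarrow> (real \<Rightarrow> complex) \<Rightarrow> bool" where
  "abs_integrable_along \<gamma> f \<longleftrightarrow>
     (\<lambda>s. f s * vector_derivative \<gamma> (at s within {0..1})) absolutely_integrable_on {0..1}"

text \<open>
  Only the behaviour on the open interval is constrained, so that a contour may start or end
  at a branch point or at infinity. Every \<open>valid_path\<close> is such a contour.
\<close>
definition open_contour :: "(real \<Rightarrow> complex) \<Rightarrow> bool" where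
  "open_contour \<gamma> \<longleftrightarrow>
     (\<forall>u v. 0 < u \<longrightarrow> u < v \<longrightarrow> v < 1 \<longrightarrow> \<gamma> piecewise_C1_differentiable_on {u..v})"

definition endpoint_difference_vanishes :: "(real \<Rightarrow> complex) \<Rightarrow> bool" where
  "endpoint_difference_vanishes f \<longleftrightarrow>
     (\<exists>l0 l1. (f \<longlongrightarrow> l0) (at_right 0) \<and> (f \<longlongrightarrow> l1) (at_left 1) \<and> l1 - l0 = 0)"

text \<open>
  At endpoints where \<open>f\<close> is continuous the limits are plain values.
\<close>
lemma endpoint_difference_vanishes_iff:
  assumes "continuous_on {0..1} f"
  shows "endpoint_difference_vanishes f \<longleftrightarrow> f 1 - f 0 = 0"
proof -
  have 0: "(f \<longlongrightarrow> f 0) (at_right 0)" and 1: "(f \<longlongrightarrow> f 1) (at_left 1)"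
    using continuous_on_Icc_at_rightD[OF assms] continuous_on_Icc_at_leftD[OF assms] by auto
  show ?thesis
    unfolding endpoint_difference_vanishes_def
    using 0 1 tendsto_unique[OF _ 0] tendsto_unique[OF _ 1]
    by (metis trivial_limit_at_left_real trivial_limit_at_right_real)
qed

lemma open_contour_valid_path:
  assumes "valid_path \<gamma>"
  shows "open_contour \<gamma>"
  using assms piecewise_C1_differentiable_on_subset
  by (fastforce simp: open_contour_def valid_path_def)

end

theory Submission
  imports Defs
begin

text \<open>
  The integrand satisfies the hypergeometric equation in \<open>z\<close> up to a total derivative in \<open>t\<close>:
  applying the operator to \<open>t powr (b - c) * (1 - t) powr (c - a - 1) * (t - z) powr (- b)\<close>
  gives \<open>- b\<close> times the \<open>t\<close>-derivative of the boundary term (\<open>boundary_term_derivative\<close>).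
  Integrating along the contour, the operator applied to the integral is \<open>- b\<close> times the difference
  of the boundary values, which vanishes by assumption. What remains is to justify differentiation
  under the integral sign and the fundamental theorem of calculus on a contour that may be singular
  at its ends.

  If the integral converges absolutely for every parameter in the open set, both are direct
  (\<open>euler_integral_abs_convergent\<close>). The contour keeps a positive distance from a disc around the
  parameter, so the logarithm of \<open>t - w\<close> varies by a bounded amount on a smaller disc. One integrand
  then dominates all those nearby, and a Taylor estimate integrates to differentiability
  (\<open>kernel_integral_has_derivative\<close>).

  For a contour that avoids 0 and 1 including its ends, the integrand is bounded. Still, the speed of
  a piecewise continuously differentiable path may be unbounded near its finitely many exceptional
  parameters, so the integral may converge only conditionally and domination fails. In this case the
  integrand is locally a holomorphic function of the position, and short arcs can be replaced by
  segments with the same end points (\<open>boundary_formula_on_near_point\<close>). Each piece yields its own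
  boundary difference, and these telescope (\<open>boundary_formula_on_join\<close>).
\<close>

section \<open>Logarithms along curves\<close>

text \<open>
  Near \<open>x\<close> a continuous logarithm is \<open>L x + Ln (g y / g x)\<close>, so it inherits differentiability
  from \<open>g\<close>. The statement is about Frechet derivatives because it serves both for the complex
  parameter and for the real parameter of the curve.
\<close>
lemma log_lift_has_derivative:
  fixes L g :: "'a::real_normed_vector \<Rightarrow> complex"
  assumes L: "isCont L x" and exp_L: "\<forall>\<^sub>F y in nhds x. exp (L y) = g y"
    and g: "(g has_derivative g') (at x)"
  shows "(L has_derivative (\<lambda>h. g' h / g x)) (at x)"
proof -
  have gx: "exp (L x) = g x" using exp_L by (rule eventually_nhds_x_imp_x)
  then have "g x \<noteq> 0" by (metis exp_not_eq_zero)
  have lim: "((\<lambda>y. L y - L x) \<longlongrightarrow> L x - L x) (nhds x)"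
    using L by (intro tendsto_diff) (auto simp: continuous_at_imp_continuous_within continuous_at isCont_def tendsto_nhds_iff)
  have "\<forall>\<^sub>F y in nhds x. norm (L y - L x) < pi"
    using tendstoD[OF lim pi_gt_zero] by (simp add: dist_norm)
  with exp_L have "\<forall>\<^sub>F y in nhds x. L x + Ln (g y / g x) = L y"
  proof eventually_elim
    case (elim y)
    have "\<bar>Im (L y - L x)\<bar> < pi" using elim(2) abs_Im_le_cmod[of "L y - L x"] by linarith
    moreover have "g y / g x = exp (L y - L x)" using elim(1) gx by (simp add: exp_diff)
    ultimately show ?case by (simp add: abs_less_iff)
  qed
  then have ev: "\<forall>\<^sub>F y in at x. L x + Ln (g y / g x) = L y"
    by (simp add: eventually_at_filter eventually_mono)
  have "(Ln has_derivative (\<lambda>h. h)) (at (g x / g x))"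
    using has_field_derivative_Ln[of 1] \<open>g x \<noteq> 0\<close>
    by (simp add: has_field_derivative_def fun_eq_iff[of "(*) 1"] mult_1[abs_def])
  from diff_chain_at[OF bounded_linear.has_derivative[OF bounded_linear_divide g, of "g x"] this]
  have "((\<lambda>y. L x + Ln (g y / g x)) has_derivative (\<lambda>h. g' h / g x)) (at x)"
    by (auto intro!: derivative_eq_intros simp: o_def)
  from has_derivative_transform_eventually[OF this ev] \<open>g x \<noteq> 0\<close> show ?thesis by simp
qed

lemma log_branch_on_parameter:
  assumes z: "z \<in> U" and L2: "log_branch_on (U \<times> S) (\<lambda>(w, s). L2 w s) (\<lambda>(w, s). \<gamma> s - w)"
  shows "log_branch_on S (L2 z) (\<lambda>s. \<gamma> s - z)"
proof -
  have "continuous_on S ((\<lambda>(w, s). L2 w s) \<circ> (\<lambda>s. (z, s)))"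
    using L2 z by (intro continuous_on_compose continuous_intros) (auto simp: log_branch_on_def elim!: continuous_on_subset)
  then show ?thesis using L2 z by (auto simp: log_branch_on_def o_def)
qed

lemma log_branch_parameter_derivative:
  assumes U: "open U" "w \<in> U" and s: "s \<in> S"
    and L2: "log_branch_on (U \<times> S) (\<lambda>(w, s). L2 w s) (\<lambda>(w, s). \<gamma> s - w)"
  shows "((\<lambda>w. L2 w s) has_field_derivative - 1 / (\<gamma> s - w)) (at w)"
proof -
  have "continuous_on U ((\<lambda>(w, s). L2 w s) \<circ> (\<lambda>w. (w, s)))"
    using L2 s by (intro continuous_on_compose continuous_intros) (auto simp: log_branch_on_def elim!: continuous_on_subset)
  then have "isCont (\<lambda>w. L2 w s) w"
    using U by (simp add: o_def continuous_on_eq_continuous_at)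
  moreover have "\<forall>\<^sub>F y in nhds w. exp (L2 y s) = \<gamma> s - y"
    using eventually_nhds_in_open[OF U] by (rule eventually_mono) (use L2 s in \<open>auto simp: log_branch_on_def\<close>)
  moreover have "((\<lambda>w. \<gamma> s - w) has_derivative uminus) (at w)"
    by (auto intro!: derivative_eq_intros)
  ultimately have "((\<lambda>w. L2 w s) has_derivative (\<lambda>h. - h / (\<gamma> s - w))) (at w)"
    by (rule log_lift_has_derivative)
  then show ?thesis unfolding has_field_derivative_def
    by (rule has_derivative_eq_rhs) (simp add: fun_eq_iff divide_inverse)
qed

lemma log_branch_curve_derivative:
  assumes L: "log_branch_on {0<..<1} L g" and s: "s \<in> {0<..<1}"
    and g: "(g has_vector_derivative D) (at s)"
  shows "(L has_vector_derivative D / g s) (at s)"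
proof -
  have "isCont L s" using L s by (auto simp: log_branch_on_def continuous_on_eq_continuous_at)
  moreover have "\<forall>\<^sub>F y in nhds s. exp (L y) = g y"
    using eventually_nhds_in_open[OF open_greaterThanLessThan s]
    by (rule eventually_mono) (use L in \<open>auto simp: log_branch_on_def\<close>)
  ultimately have "(L has_derivative (\<lambda>h. (h *\<^sub>R D) / g s)) (at s)"
    using g unfolding has_vector_derivative_def by (rule log_lift_has_derivative)
  then show ?thesis unfolding has_vector_derivative_def
    by (rule has_derivative_eq_rhs) (simp add: fun_eq_iff scaleR_conv_of_real)
qed

text \<open>
  The quotient lies in the open unit disc around 1, where \<open>Ln\<close> is holomorphic.
\<close>
lemma quotient_notin_nonpos_Reals_of_near:
  fixes w w0 :: complex
  assumes "norm (w - w0) < norm w0"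
  shows "w / w0 \<notin> \<real>\<^sub>\<le>\<^sub>0"
proof
  assume "w / w0 \<in> \<real>\<^sub>\<le>\<^sub>0"
  then have "1 \<le> norm (w / w0 - 1)"
    using abs_Re_le_cmod[of "w / w0 - 1"] by (auto simp: complex_nonpos_Reals_iff)
  moreover have "w0 \<noteq> 0" using assms by auto
  then have "norm (w / w0 - 1) = norm (w - w0) / norm w0" by (simp add: norm_divide[symmetric] diff_divide_distrib)
  ultimately have "1 \<le> norm (w - w0) / norm w0" by simp
  with assms \<open>w0 \<noteq> 0\<close> show False by (simp add: le_divide_eq)
qed

lemma log_branch_on_near:
  fixes w :: "'a::topological_space \<Rightarrow> complex"
  assumes w: "continuous_on S w" and near: "\<And>x. x \<in> S \<Longrightarrow> norm (w x - w0) < norm w0" and k: "exp k = w0"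
  shows "log_branch_on S (\<lambda>x. k + Ln (w x / w0)) w"
proof -
  have "w0 \<noteq> 0" using k exp_not_eq_zero by blast
  moreover have "w x \<noteq> 0" if "x \<in> S" for x using near[OF that] by auto
  moreover have "continuous_on S (\<lambda>x. k + Ln (w x / w0))"
    using \<open>w0 \<noteq> 0\<close> quotient_notin_nonpos_Reals_of_near[OF near] by (intro continuous_intros w) auto
  ultimately show ?thesis using k by (auto simp: log_branch_on_def exp_add)
qed

text \<open>
  Two continuous logarithms of the same function on a connected set differ by a constant. Thus, as
  long as \<open>w\<close> stays in a disc that misses the origin, a branch is a holomorphic function of \<open>w\<close>.
\<close>
lemma log_branch_on_near_unique:
  fixes w :: "'a::topological_space \<Rightarrow> complex"
  assumes S: "connected S" "S \<noteq> {}" and L: "log_branch_on S L w"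
    and near: "\<And>x. x \<in> S \<Longrightarrow> norm (w x - w0) < norm w0"
  obtains k where "exp k = w0" "\<And>x. x \<in> S \<Longrightarrow> L x = k + Ln (w x / w0)"
proof -
  have expL: "exp (L x) = w x" if "x \<in> S" for x using L that by (auto simp: log_branch_on_def)
  have w0: "w0 \<noteq> 0" using S near by fastforce
  have cont_L: "continuous_on S L" using L by (simp add: log_branch_on_def)
  then have "continuous_on S w"
    using continuous_on_exp[OF cont_L] expL by (simp cong: continuous_on_cong)
  then have "log_branch_on S (\<lambda>x. Ln w0 + Ln (w x / w0)) w"
    using near w0 by (intro log_branch_on_near) auto
  then have "continuous_on S (\<lambda>x. Ln w0 + Ln (w x / w0))" by (simp add: log_branch_on_def)
  from continuous_on_diff[OF this continuous_on_const[of S "Ln w0"]]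
  have "continuous_on S (\<lambda>x. Ln (w x / w0))" by simp
  then have cont_diff: "continuous_on S (\<lambda>x. L x - Ln (w x / w0))"
    using cont_L by (rule continuous_on_diff[rotated])
  have exp_quot: "exp (L x - Ln (w x / w0)) = w0" if "x \<in> S" for x
  proof -
    have "w x \<noteq> 0" using near[OF that] by auto
    then show ?thesis using expL[OF that] w0 by (simp add: exp_diff)
  qed
  have "(\<lambda>x. L x - Ln (w x / w0)) constant_on S"
  proof (rule continuous_discrete_range_constant[OF S(1) cont_diff])
    fix x assume x: "x \<in> S"
    \<comment> \<open>Two logarithms of \<open>w0\<close> closer than \<open>2 * pi\<close> coincide.\<close>
    have "2 * pi \<le> norm ((L y - Ln (w y / w0)) - (L x - Ln (w x / w0)))"
      if "y \<in> S" "L y - Ln (w y / w0) \<noteq> L x - Ln (w x / w0)" for y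
      using exp_complex_eqI[of "L y - Ln (w y / w0)" "L x - Ln (w x / w0)"] exp_quot[OF x] exp_quot[OF that(1)] that(2)
        abs_Im_le_cmod[of "(L y - Ln (w y / w0)) - (L x - Ln (w x / w0))"] by fastforce
    then show "\<exists>e>0. \<forall>y. y \<in> S \<and> L y - Ln (w y / w0) \<noteq> L x - Ln (w x / w0) \<longrightarrow>
        e \<le> norm (L y - Ln (w y / w0) - (L x - Ln (w x / w0)))"
      by (intro exI[of _ "2 * pi"]) auto
  qed
  then obtain k where k: "\<And>x. x \<in> S \<Longrightarrow> L x - Ln (w x / w0) = k" by (auto simp: constant_on_def)
  show ?thesis
  proof (rule that)
    show "exp k = w0" using S(2) exp_quot k by force
    show "L x = k + Ln (w x / w0)" if "x \<in> S" for x using k[OF that] by (simp add: algebra_simps)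
  qed
qed

section \<open>Integration and differentiation under the integral sign\<close>

text \<open>
  Dividing by \<open>\<gamma> s - w\<close> once more is what differentiation in \<open>w\<close> does to this kernel,
  because \<open>L w s\<close> is a logarithm of \<open>\<gamma> s - w\<close>. Absolute integrability at each single \<open>w\<close>
  suffices to pass under the integral: the kernels for nearby parameters are comparable, uniformly
  in \<open>s\<close>.
\<close>
lemma kernel_integral_has_derivative:
  fixes \<gamma> A :: "real \<Rightarrow> complex" and L :: "complex \<Rightarrow> real \<Rightarrow> complex" and b :: complex
  defines "f \<equiv> \<lambda>w s. exp (- b * L w s) * A s"
  assumes U: "open U" "z \<in> U" and S: "S \<in> sets lebesgue"
    and cont: "continuous_on S \<gamma>" and avoids: "\<gamma> ` S \<inter> U = {}"
    and L: "\<And>w s. w \<in> U \<Longrightarrow> s \<in> S \<Longrightarrow> ((\<lambda>w. L w s) has_field_derivative - 1 / (\<gamma> s - w)) (at w)"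
    and int: "\<And>w. w \<in> U \<Longrightarrow> f w absolutely_integrable_on S"
  shows "\<And>w k. w \<in> U \<Longrightarrow> (\<lambda>s. f w s / (\<gamma> s - w) ^ k) absolutely_integrable_on S"
    and "\<And>k. ((\<lambda>w. integral S (\<lambda>s. f w s / (\<gamma> s - w) ^ k)) has_field_derivative
          (b + of_nat k) * integral S (\<lambda>s. f z s / (\<gamma> s - z) ^ Suc k)) (at z)"
proof -
  have nz: "\<gamma> s \<noteq> w" if "w \<in> U" "s \<in> S" for w s using avoids that by auto
  show absint: "(\<lambda>s. f w s / (\<gamma> s - w) ^ k) absolutely_integrable_on S" if w: "w \<in> U" for w k
  proof -
    obtain r where r: "0 < r" "ball w r \<subseteq> U" using U(1) w openE by blast
    have far: "r \<le> norm (\<gamma> s - w)" if "s \<in> S" for s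
      using avoids r that by (force simp: dist_norm norm_minus_commute subset_iff not_less[symmetric])
    have "continuous_on S (\<lambda>s. 1 / (\<gamma> s - w) ^ k)"
      using nz[OF w] by (intro continuous_intros cont) auto
    then have "(\<lambda>s. 1 / (\<gamma> s - w) ^ k) \<in> borel_measurable (lebesgue_on S)"
      using S by (rule continuous_imp_measurable_on_sets_lebesgue)
    moreover have "bounded ((\<lambda>s. 1 / (\<gamma> s - w) ^ k) ` S)"
      unfolding bounded_iff
      by (intro exI[of _ "1 / r ^ k"])
        (auto simp: norm_divide norm_power r intro!: divide_left_mono power_mono far mult_pos_pos zero_less_power less_imp_le[OF r(1)] dest: nz[OF w])
    ultimately have "(\<lambda>s. (1 / (\<gamma> s - w) ^ k) * f w s) absolutely_integrable_on S"
      using absolutely_integrable_bounded_measurable_product[of "(*)" "\<lambda>s. 1 / (\<gamma> s - w) ^ k" S "f w"] S int[OF w]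
      by (simp add: bilinear_times)
    then show ?thesis by simp
  qed
  fix k
  define F where "F = (\<lambda>m w s. f w s / (\<gamma> s - w) ^ (k + m))"
  have F_int: "F m w integrable_on S" if "w \<in> U" for m w
    using absint[OF that] unfolding F_def by (rule set_lebesgue_integral_eq_integral(1))
  have F': "((\<lambda>w. F m w s) has_field_derivative (b + of_nat (k + m)) * F (Suc m) w s) (at w)"
    if "w \<in> U" "s \<in> S" for m w s
  proof -
    have inv: "((\<lambda>w. inverse (\<gamma> s - w) ^ (k + m)) has_field_derivative
        of_nat (k + m) * inverse (\<gamma> s - w) ^ Suc (k + m)) (at w)"
    proof -
      have "((\<lambda>w. inverse (\<gamma> s - w)) has_field_derivative inverse (\<gamma> s - w) ^ 2) (at w)"
        using nz[OF that] by (auto intro!: derivative_eq_intros simp: field_simps power2_eq_square)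
      from DERIV_power[OF this, of "k + m"] show ?thesis
        by (cases "k + m") (simp_all add: power2_eq_square mult_ac)
    qed
    have "((\<lambda>w. - b * L w s) has_field_derivative - b * (- 1 / (\<gamma> s - w))) (at w)"
      by (rule DERIV_cmult[OF L[OF that]])
    from DERIV_cmult_right[OF DERIV_fun_exp[OF this], of "A s"]
    have "((\<lambda>w. f w s) has_field_derivative f w s * (- b * (- 1 / (\<gamma> s - w)))) (at w)"
      unfolding f_def by (simp add: mult_ac)
    note d = DERIV_mult[OF this inv]
    have "f w s * (- b * (- 1 / u)) * inverse u ^ n + of_nat n * inverse u ^ Suc n * f w s =
        (b + of_nat n) * (f w s / u ^ Suc n)" for u :: complex and n
      by (simp add: divide_inverse power_inverse algebra_simps)
    note d' = DERIV_cong[OF d this]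
    have "(\<lambda>w. F m w s) = (\<lambda>w. f w s * inverse (\<gamma> s - w) ^ (k + m))"
      by (simp add: F_def divide_inverse power_inverse)
    with d' show ?thesis by (simp add: F_def)
  qed
  \<comment> \<open>The curve avoids the ball of radius \<open>2 * r\<close>, so it keeps distance \<open>r\<close> from every parameter in
    the ball of radius \<open>r\<close>.\<close>
  obtain r where r: "0 < r" "ball z (2 * r) \<subseteq> U"
    using U openE[of U z] by (metis field_sum_of_halves half_gt_zero mult_2)
  have far: "r \<le> norm (\<gamma> s - w)" if "s \<in> S" "w \<in> ball z r" for s w
  proof -
    have "\<gamma> s \<notin> ball z (2*r)" using avoids r(2) that(1) by blast
    then have "2 * r \<le> norm (\<gamma> s - z)" by (simp add: dist_norm norm_minus_commute)
    moreover have "norm (w - z) < r" using that by (simp add: dist_norm norm_minus_commute)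
    ultimately show ?thesis using norm_triangle_ineq[of "\<gamma> s - w" "w - z"] by simp
  qed
  have ballU: "ball z r \<subseteq> U" using r by (auto intro: order.trans[rotated])
  \<comment> \<open>The logarithmic derivative of \<open>f w s\<close> in \<open>w\<close> is at most \<open>norm b / r\<close> on the ball, so moving
    the parameter by less than \<open>r\<close> multiplies \<open>f\<close> by a factor of at most \<open>exp (norm b)\<close>.\<close>
  have dom: "norm (F m w s) \<le> exp (norm b) * norm (f z s) / r ^ (k + m)" if "s \<in> S" "w \<in> ball z r" for m w s
  proof -
    have "norm (L w s - L z s) \<le> (1 / r) * norm (w - z)"
    proof (rule field_differentiable_bound[where S = "ball z r"])
      fix v assume v: "v \<in> ball z r"
      show "((\<lambda>v. L v s) has_field_derivative - 1 / (\<gamma> s - v)) (at v within ball z r)"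
        using L v that ballU has_field_derivative_at_within by blast
      show "norm (- 1 / (\<gamma> s - v)) \<le> 1 / r"
        using far[OF that(1) v] r by (auto simp: norm_divide intro!: frac_le)
    qed (use that r in auto)
    also have "\<dots> \<le> 1" using that r by (simp add: dist_norm norm_minus_commute)
    finally have "norm (- b * (L w s - L z s)) \<le> norm b"
      by (metis mult_left_le norm_ge_zero norm_minus_cancel norm_mult mult_minus_left)
    then have "norm (exp (- b * (L w s - L z s))) \<le> exp (norm b)"
      by (metis dual_order.trans exp_le_cancel_iff norm_exp)
    then have "norm (f z s) * norm (exp (- b * (L w s - L z s))) \<le> norm (f z s) * exp (norm b)"
      by (intro mult_left_mono) auto
    also have "norm (f z s) * norm (exp (- b * (L w s - L z s))) = norm (f w s)"
    proof -
      have "exp (- b * L w s) = exp (- b * L z s) * exp (- b * (L w s - L z s))"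
        unfolding exp_add[symmetric] by (simp add: algebra_simps)
      then show ?thesis by (simp only: f_def norm_mult mult_ac)
    qed
    finally show ?thesis using far[OF that] r
      by (auto simp: F_def norm_divide norm_power mult.commute[of "exp _"] intro!: frac_le power_mono)
  qed
  define C where "C = norm ((b + of_nat k) * (b + of_nat (Suc k))) * exp (norm b) / r ^ (k + 2)"
  \<comment> \<open>A second-order Taylor estimate, integrable in \<open>s\<close>, which makes the integrated difference
    quotient converge with error \<open>D * norm (w - z)\<close>.\<close>
  have taylor: "norm (F 0 w s - F 0 z s - (b + of_nat k) * F 1 z s * (w - z)) \<le> C * norm (w - z) ^ 2 * norm (f z s)"
    if s: "s \<in> S" and w: "w \<in> ball z r" for w s
  proof -
    define G where "G = (\<lambda>i::nat. if i = 0 then (\<lambda>w. F 0 w s) else if i = 1 then (\<lambda>w. (b + of_nat k) * F 1 w s)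
       else (\<lambda>w. (b + of_nat k) * ((b + of_nat (Suc k)) * F 2 w s)))"
    have "norm (G 0 w - (\<Sum>i\<le>1. G i z * (w - z) ^ i / fact i)) \<le> (C * norm (f z s)) * norm (w - z) ^ Suc 1 / fact 1"
    proof (rule complex_Taylor[where S = "ball z r"])
      fix i :: nat and x assume x: "x \<in> ball z r" and i: "i \<le> 1"
      have "x \<in> U" using x ballU by auto
      have "((G i) has_field_derivative G (Suc i) x) (at x)"
      proof (cases "i = 0")
        case True
        then show ?thesis using F'[OF \<open>x \<in> U\<close> s, of 0] by (simp add: G_def)
      next
        case False
        with i have "i = 1" by simp
        have "((\<lambda>w. (b + of_nat k) * F 1 w s) has_field_derivative (b + of_nat k) * ((b + of_nat (k+1)) * F (Suc 1) x s)) (at x)"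
          by (rule DERIV_cmult[OF F'[OF \<open>x \<in> U\<close> s, of 1]])
        then show ?thesis using \<open>i = 1\<close> by (simp add: G_def numeral_2_eq_2)
      qed
      then show "((G i) has_field_derivative G (Suc i) x) (at x within ball z r)"
        by (rule has_field_derivative_at_within)
    next
      fix x assume x: "x \<in> ball z r"
      have "norm (G (Suc 1) x) = norm ((b + of_nat k) * (b + of_nat (Suc k))) * norm (F 2 x s)"
        by (simp add: G_def norm_mult)
      also have "\<dots> \<le> norm ((b + of_nat k) * (b + of_nat (Suc k))) * (exp (norm b) * norm (f z s) / r ^ (k + 2))"
        by (intro mult_left_mono dom s x) auto
      also have "\<dots> = C * norm (f z s)" by (simp add: C_def)
      finally show "norm (G (Suc 1) x) \<le> C * norm (f z s)" .
    qed (use w r in auto)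
    then show ?thesis by (simp add: G_def power2_eq_square mult_ac algebra_simps)
  qed
  define I where "I = (\<lambda>m w. integral S (F m w))"
  define D where "D = C * integral S (\<lambda>s. norm (f z s))"
  have bound: "norm (I 0 w - I 0 z - (b + of_nat k) * I 1 z * (w - z)) \<le> D * norm (w - z) ^ 2"
    if w: "w \<in> ball z r" for w
  proof -
    have wU: "w \<in> U" using w ballU by auto
    have i1: "(\<lambda>s. (b + of_nat k) * F 1 z s * (w - z)) integrable_on S"
      using integrable_on_mult_left[OF integrable_on_mult_right[OF F_int[OF U(2), of 1]]] by simp
    have i2: "(\<lambda>s. F 0 w s - F 0 z s) integrable_on S"
      by (intro integrable_diff F_int wU U)
    have "I 0 w - I 0 z - (b + of_nat k) * I 1 z * (w - z) =
        integral S (\<lambda>s. F 0 w s - F 0 z s - (b + of_nat k) * F 1 z s * (w - z))"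
      unfolding I_def using F_int[OF wU] F_int[OF U(2)] i1 i2 by (simp add: integral_diff)
    also have "norm \<dots> \<le> integral S (\<lambda>s. C * norm (w - z) ^ 2 * norm (f z s))"
    proof (rule integral_norm_bound_integral)
      have "(\<lambda>s. norm (f z s)) integrable_on S"
        using int[OF U(2)] absolutely_integrable_on_def by blast
      then show "(\<lambda>s. C * norm (w - z) ^ 2 * norm (f z s)) integrable_on S"
        by (rule integrable_on_mult_right)
      show "(\<lambda>s. F 0 w s - F 0 z s - (b + of_nat k) * F 1 z s * (w - z)) integrable_on S"
        by (intro integrable_diff i1 i2)
    qed (use taylor w in auto)
    also have "\<dots> = D * norm (w - z) ^ 2" by (simp add: D_def)
    finally show ?thesis .
  qed
  have "((\<lambda>w. I 0 w) has_field_derivative (b + of_nat k) * I 1 z) (at z)"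
    unfolding has_field_derivative_iff
  proof (rule LIM_zero_cancel, rule Lim_null_comparison)
    have "\<forall>\<^sub>F w in at z. w \<in> ball z r" using r by (intro eventually_at_in_open') auto
    moreover have "\<forall>\<^sub>F w in at z. w \<noteq> z" by (simp add: eventually_at_filter)
    ultimately
    show "\<forall>\<^sub>F w in at z. norm ((I 0 w - I 0 z) / (w - z) - (b + of_nat k) * I 1 z) \<le> D * norm (w - z)"
    proof eventually_elim
      case (elim w)
      have "norm ((I 0 w - I 0 z) / (w - z) - (b + of_nat k) * I 1 z) =
          norm (I 0 w - I 0 z - (b + of_nat k) * I 1 z * (w - z)) / norm (w - z)"
        using elim by (simp add: norm_divide[symmetric] diff_divide_distrib)
      also have "\<dots> \<le> D * norm (w - z) ^ 2 / norm (w - z)"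
        by (intro divide_right_mono bound elim) auto
      finally show ?case using elim by (simp add: power2_eq_square)
    qed
    show "((\<lambda>w. D * norm (w - z)) \<longlongrightarrow> 0) (at z)"
      by (auto intro!: tendsto_eq_intros)
  qed
  then show "((\<lambda>w. integral S (\<lambda>s. f w s / (\<gamma> s - w) ^ k)) has_field_derivative
          (b + of_nat k) * integral S (\<lambda>s. f z s / (\<gamma> s - z) ^ Suc k)) (at z)"
    by (simp add: I_def F_def)
qed

text \<open>
  The fundamental theorem of calculus with both end points reached as limits. A primitive on compact
  subintervals differs by a constant from the indefinite integral, which is continuous up to the ends.
  In this form it applies to contours whose corners accumulate at the ends.
\<close>
lemma integral_eq_of_local_antiderivative:
  fixes B h :: "real \<Rightarrow> complex"
  assumes h: "h integrable_on {0..1}"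
    and ftc: "\<And>u v. 0 < u \<Longrightarrow> u < v \<Longrightarrow> v < 1 \<Longrightarrow> (h has_integral B v - B u) {u..v}"
    and l0: "(B \<longlongrightarrow> l0) (at_right 0)" and l1: "(B \<longlongrightarrow> l1) (at_left 1)"
  shows "integral {0..1} h = l1 - l0"
proof -
  define J where "J = (\<lambda>x. integral {0..x} h)"
  have J: "continuous_on {0..1} J"
    unfolding J_def by (rule indefinite_integral_continuous_1[OF h])
  have JB: "B v - B u = J v - J u" if "0 < u" "u < v" "v < 1" for u v
  proof -
    have "J u + integral {u..v} h = J v" unfolding J_def
      using that by (intro Henstock_Kurzweil_Integration.integral_combine integrable_on_subinterval[OF h]) auto
    with integral_unique[OF ftc[OF that]] show ?thesis by (metis add_diff_cancel_left')
  qed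
  define k where "k = B (1/2) - J (1/2)"
  have k: "B x = J x + k" if "0 < x" "x < 1" for x
  proof (cases x "1/2 :: real" rule: linorder_cases)
    case less
    with JB[of x "1/2"] that show ?thesis by (simp add: k_def algebra_simps)
  next
    case greater
    with JB[of "1/2" x] that show ?thesis by (simp add: k_def algebra_simps)
  next
    case equal
    show ?thesis unfolding equal k_def by simp
  qed
  have "(J \<longlongrightarrow> J 0) (at_right 0)" "(J \<longlongrightarrow> J 1) (at_left 1)"
    using continuous_on_Icc_at_rightD[OF J] continuous_on_Icc_at_leftD[OF J] by auto
  then have J0: "((\<lambda>x. J x + k) \<longlongrightarrow> J 0 + k) (at_right 0)" and J1: "((\<lambda>x. J x + k) \<longlongrightarrow> J 1 + k) (at_left 1)"
    by (auto intro: tendsto_intros)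
  have "\<forall>\<^sub>F x in at_right 0. J x + k = B x"
    using eventually_at_right_real[OF zero_less_one] by (rule eventually_mono) (simp add: k)
  from Lim_transform_eventually[OF J0 this] have "l0 = J 0 + k"
    using l0 tendsto_unique trivial_limit_at_right_real by blast
  moreover have "\<forall>\<^sub>F x in at_left 1. J x + k = B x"
    using eventually_at_left_real[OF zero_less_one] by (rule eventually_mono) (simp add: k)
  from Lim_transform_eventually[OF J1 this] have "l1 = J 1 + k"
    using l1 tendsto_unique trivial_limit_at_left_real by blast
  ultimately show ?thesis by (simp add: J_def)
qed

text \<open>
  The integrand is the derivative of \<open>H \<circ> \<gamma>\<close> off a finite set, which is enough for the gauge
  integral, even where the speed of the curve is unbounded.
\<close>
lemma has_integral_along_piece_of_primitive:
  fixes G H :: "complex \<Rightarrow> complex"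
  assumes \<gamma>: "\<gamma> piecewise_C1_differentiable_on {u..v}" and uv: "0 \<le> u" "u \<le> v" "v \<le> 1"
    and N: "\<gamma> ` {u..v} \<subseteq> N"
    and H: "\<And>t. t \<in> N \<Longrightarrow> (H has_field_derivative G t) (at t)"
  shows "((\<lambda>s. G (\<gamma> s) * vector_derivative \<gamma> (at s within {0..1})) has_integral H (\<gamma> v) - H (\<gamma> u)) {u..v}"
proof -
  obtain X where X: "finite X" "\<gamma> C1_differentiable_on {u..v} - X" and cont: "continuous_on {u..v} \<gamma>"
    using \<gamma> by (auto simp: piecewise_C1_differentiable_on_def)
  have "((\<lambda>s. G (\<gamma> s) * vector_derivative \<gamma> (at s within {0..1})) has_integral
      (H \<circ> \<gamma>) v - (H \<circ> \<gamma>) u) {u..v}"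
  proof (rule fundamental_theorem_of_calculus_strong[OF X(1) uv(2)])
    have "continuous_on N H"
      using H by (meson DERIV_isCont continuous_at_imp_continuous_on)
    then show "continuous_on {u..v} (H \<circ> \<gamma>)"
      by (intro continuous_on_compose cont continuous_on_subset[OF _ N])
    fix s assume s: "s \<in> {u..v} - X"
    then obtain D where D: "(\<gamma> has_vector_derivative D) (at s)"
      using X(2) unfolding C1_differentiable_on_def by blast
    have "vector_derivative \<gamma> (at s within {0..1}) = D"
      using s uv by (intro vector_derivative_at_within_ivl[OF D]) auto
    moreover have "\<gamma> s \<in> N" using N s by auto
    ultimately
    show "(H \<circ> \<gamma> has_vector_derivative G (\<gamma> s) * vector_derivative \<gamma> (at s within {0..1})) (at s)"
      using field_vector_diff_chain_at[OF D H] by (simp add: mult.commute)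
  qed
  then show ?thesis by simp
qed

section \<open>The integrand and the boundary term\<close>

text \<open>
  Reads the boundary term with the integrand as a common factor, which turns the identity for its
  derivative into one between rational functions of \<open>t\<close>.
\<close>
lemma boundary_term_eq:
  assumes "exp (L0 s) = t" "exp (L1 s) = 1 - t" "exp (L2 z s) = t - z"
  shows "boundary_term a b c L0 L1 L2 z s = euler_integrand a b c L0 L1 L2 z s * (t * (1 - t) / (t - z))"
proof -
  have e0: "exp ((b - c + 1) * L0 s) = exp ((b - c) * L0 s) * t"
    unfolding assms(1)[symmetric] exp_add[symmetric] by (simp add: algebra_simps)
  have e1: "exp ((c - a) * L1 s) = exp ((c - a - 1) * L1 s) * (1 - t)"
    unfolding assms(2)[symmetric] exp_add[symmetric] by (simp add: algebra_simps)
  have e2: "exp ((- b - 1) * L2 z s) = exp (- b * L2 z s) / (t - z)"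
    unfolding assms(3)[symmetric] exp_diff[symmetric] by (simp add: algebra_simps)
  show ?thesis unfolding boundary_term_def euler_integrand_def e0 e1 e2 by simp
qed

text \<open>
  Multiplied by \<open>- b\<close>, the right-hand side is the hypergeometric operator applied to the integrand
  (times \<open>D\<close>). With \<open>t = \<gamma> s\<close> and \<open>u = t - z\<close> the identity comes from the expansion
  \<open>t * (1 - t) = z * (1 - z) + (1 - 2 * z) * u - u^2\<close>, sorted by powers of \<open>u\<close>.
  The powers \<open>1 / u\<close> and \<open>1 / u^2\<close> are those produced by the first and second derivatives in \<open>z\<close>.
\<close>
lemma boundary_term_derivative:
  fixes a b c z :: complex
  assumes s: "s \<in> {0<..<1}" and D: "(\<gamma> has_vector_derivative D) (at s)"
    and L0: "log_branch_on {0<..<1} L0 \<gamma>"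
    and L1: "log_branch_on {0<..<1} L1 (\<lambda>s. 1 - \<gamma> s)"
    and L2: "log_branch_on {0<..<1} (L2 z) (\<lambda>s. \<gamma> s - z)"
  defines "f \<equiv> euler_integrand a b c L0 L1 L2 z s * D"
  shows "(boundary_term a b c L0 L1 L2 z has_vector_derivative
    - ((b + 1) * z * (1 - z) * (f / (\<gamma> s - z) ^ 2) + (c - (a + b + 1) * z) * (f / (\<gamma> s - z)) - a * f)) (at s)"
proof -
  let ?E = "euler_integrand a b c L0 L1 L2 z s"
  let ?B = "boundary_term a b c L0 L1 L2 z"
  have exps: "exp (L0 s) = \<gamma> s" "exp (L1 s) = 1 - \<gamma> s" "exp (L2 z s) = \<gamma> s - z"
    using L0 L1 L2 s by (auto simp: log_branch_on_def)
  have nz: "\<gamma> s \<noteq> 0" "1 - \<gamma> s \<noteq> 0" "\<gamma> s - z \<noteq> 0"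
    using exps exp_not_eq_zero by metis+
  have d0: "(L0 has_vector_derivative D / \<gamma> s) (at s)"
    by (rule log_branch_curve_derivative[OF L0 s D])
  have d1: "(L1 has_vector_derivative - D / (1 - \<gamma> s)) (at s)"
    by (rule log_branch_curve_derivative[OF L1 s]) (auto intro!: derivative_eq_intros D)
  have d2: "(L2 z has_vector_derivative D / (\<gamma> s - z)) (at s)"
    by (rule log_branch_curve_derivative[OF L2 s]) (auto intro!: derivative_eq_intros D)
  define M where "M = (\<lambda>s. (b - c + 1) * L0 s + (c - a) * L1 s + (- b - 1) * L2 z s)"
  have B: "?B = exp \<circ> M" by (simp add: fun_eq_iff boundary_term_def M_def exp_add)
  have "(M has_vector_derivative ((b - c + 1) * (D / \<gamma> s) + (c - a) * (- D / (1 - \<gamma> s)) + (- b - 1) * (D / (\<gamma> s - z)))) (at s)"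
    unfolding M_def by (intro has_vector_derivative_add has_vector_derivative_mult_right d0 d1 d2)
  from field_vector_diff_chain_at[OF this DERIV_exp]
  have "(?B has_vector_derivative
      ((b - c + 1) * (D / \<gamma> s) + (c - a) * (- D / (1 - \<gamma> s)) + (- b - 1) * (D / (\<gamma> s - z))) * ?B s) (at s)"
    by (simp add: B)
  moreover have "((b - c + 1) * (D / \<gamma> s) + (c - a) * (- D / (1 - \<gamma> s)) + (- b - 1) * (D / (\<gamma> s - z))) * ?B s =
    - ((b + 1) * z * (1 - z) * (f / (\<gamma> s - z) ^ 2) + (c - (a + b + 1) * z) * (f / (\<gamma> s - z)) - a * f)"
  proof -
    define t where "t = \<gamma> s"
    define u where "u = t - z"
    have nz': "t \<noteq> 0" "1 - t \<noteq> 0" "u \<noteq> 0" using nz by (auto simp: t_def u_def)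
    have "((b - c + 1) * (D / t) + (c - a) * (- D / (1 - t)) + (- b - 1) * (D / u)) * (?E * (t * (1 - t) / u))
      = ?E * D * ((b - c + 1) * (1 - t) * u - (c - a) * t * u - (b + 1) * (t * (1 - t))) / u ^ 2"
      using nz' by (simp add: divide_simps power2_eq_square) (simp add: algebra_simps)
    also have "(b - c + 1) * (1 - t) * u - (c - a) * t * u - (b + 1) * (t * (1 - t)) =
       - ((b + 1) * z * (1 - z) + (c - (a + b + 1) * z) * u - a * u ^ 2)"
      unfolding u_def by algebra
    also have "?E * D * - ((b + 1) * z * (1 - z) + (c - (a + b + 1) * z) * u - a * u ^ 2) / u ^ 2 =
       - ((b + 1) * z * (1 - z) * (f / u ^ 2) + (c - (a + b + 1) * z) * (f / u) - a * f)"
      using nz' by (simp add: f_def divide_simps power2_eq_square) (simp add: algebra_simps)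
    finally show ?thesis unfolding boundary_term_eq[of L0 s "\<gamma> s" L1 L2 z, OF exps] t_def u_def .
  qed
  ultimately show ?thesis by simp
qed

section \<open>Absolutely convergent integrals\<close>

lemma open_contour_continuous_on:
  assumes "open_contour \<gamma>"
  shows "continuous_on {0<..<1} \<gamma>"
proof (rule continuous_at_imp_continuous_on, rule ballI)
  fix x :: real assume x: "x \<in> {0<..<1}"
  have "\<gamma> piecewise_C1_differentiable_on {x/2..(x+1)/2}"
    using assms x by (auto simp: open_contour_def)
  then have "continuous_on {x/2..(x+1)/2} \<gamma>" by (simp add: piecewise_C1_differentiable_on_def)
  then show "isCont \<gamma> x" using x by (intro continuous_on_interior[of "{x/2..(x+1)/2}"]) auto
qed

text \<open>
  The first and second derivatives of the integral are \<open>b * J 1\<close> and \<open>b * (b + 1) * J 2\<close>, where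
  \<open>J k\<close> is the integral with \<open>k\<close> extra factors \<open>1 / (\<gamma> s - w)\<close>. Hence the operator yields
  \<open>- b\<close> times the integral of the derivative of the boundary term. The end values are kept
  arbitrary because the formula is also applied to pieces of a contour.
\<close>
lemma euler_integral_abs_convergent:
  fixes a b c :: complex and \<gamma> L0 L1 :: "real \<Rightarrow> complex" and L2 :: "complex \<Rightarrow> real \<Rightarrow> complex"
  defines "I \<equiv> \<lambda>w. integral_along \<gamma> (euler_integrand a b c L0 L1 L2 w)"
  assumes contour: "open_contour \<gamma>"
    and U: "open U" and avoids: "\<gamma> ` {0<..<1} \<inter> U = {}"
    and L0: "log_branch_on {0<..<1} L0 \<gamma>"
    and L1: "log_branch_on {0<..<1} L1 (\<lambda>s. 1 - \<gamma> s)"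
    and L2: "log_branch_on (U \<times> {0<..<1}) (\<lambda>(w, s). L2 w s) (\<lambda>(w, s). \<gamma> s - w)"
    and absint: "\<forall>w\<in>U. abs_integrable_along \<gamma> (euler_integrand a b c L0 L1 L2 w)"
  shows "I holomorphic_on U"
    and "\<And>z l0 l1. z \<in> U \<Longrightarrow> (boundary_term a b c L0 L1 L2 z \<longlongrightarrow> l0) (at_right 0) \<Longrightarrow>
      (boundary_term a b c L0 L1 L2 z \<longlongrightarrow> l1) (at_left 1) \<Longrightarrow>
      hypergeometric_op a b c I z = - b * (l1 - l0)"
proof -
  let ?S = "{0<..<1} :: real set"
  define v :: "real \<Rightarrow> complex" where "v s = vector_derivative \<gamma> (at s within {0..1})" for s
  define A where "A = (\<lambda>s. exp ((b - c) * L0 s) * exp ((c - a - 1) * L1 s) * v s)"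
  define f where "f = (\<lambda>w s. exp (- b * L2 w s) * A s)"
  have f: "euler_integrand a b c L0 L1 L2 w s * v s = f w s" for w s
    by (simp add: euler_integrand_def f_def A_def)
  define J where "J = (\<lambda>k w. integral ?S (\<lambda>s. f w s / (\<gamma> s - w) ^ k))"
  have f_int: "f w absolutely_integrable_on ?S" if "w \<in> U" for w
  proof -
    have "f w absolutely_integrable_on {0..1}"
      using bspec[OF absint that] unfolding abs_integrable_along_def v_def[symmetric] f .
    then show ?thesis by (rule set_integrable_subset) auto
  qed
  note kernel = kernel_integral_has_derivative[where S = ?S and \<gamma> = \<gamma> and A = A and L = L2 and b = b and U = U,
      OF U(1) _ _ open_contour_continuous_on[OF contour] avoids log_branch_parameter_derivative[OF U _ _ L2] f_int[unfolded f_def]]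
  have kernel_int: "(\<lambda>s. f w s / (\<gamma> s - w) ^ k) absolutely_integrable_on ?S" if "w \<in> U" for w k
    unfolding f_def by (rule kernel(1)) (use that in auto)
  have J': "(J k has_field_derivative (b + of_nat k) * J (Suc k) w) (at w)" if "w \<in> U" for k w
    unfolding J_def f_def by (rule kernel(2)) (use that in auto)
  have I_eq: "I = J 0"
    unfolding I_def integral_along_def J_def v_def[symmetric] f by (simp add: integral_open_interval_real)
  show "I holomorphic_on U"
    unfolding I_eq holomorphic_on_open[OF U] using J' by blast

  fix z l0 l1 assume z: "z \<in> U"
    and l0: "(boundary_term a b c L0 L1 L2 z \<longlongrightarrow> l0) (at_right 0)"
    and l1: "(boundary_term a b c L0 L1 L2 z \<longlongrightarrow> l1) (at_left 1)"
  let ?B = "boundary_term a b c L0 L1 L2 z"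
  \<comment> \<open>Off the corners, \<open>h\<close> is the derivative of the boundary term along the curve; the exponents 1 and 0 are kept so
    that its integral is visibly a combination of the \<open>J k z\<close>.\<close>
  define h where "h = (\<lambda>s. - ((b + 1) * z * (1 - z) * (f z s / (\<gamma> s - z) ^ 2) +
      (c - (a + b + 1) * z) * (f z s / (\<gamma> s - z) ^ 1) - a * (f z s / (\<gamma> s - z) ^ 0)))"
  have ints: "(\<lambda>s. f z s / (\<gamma> s - z) ^ k) integrable_on ?S" for k
    using kernel_int[OF z] by (rule set_lebesgue_integral_eq_integral(1))
  have "(h has_integral - ((b + 1) * z * (1 - z) * J 2 z + (c - (a + b + 1) * z) * J 1 z - a * J 0 z)) ?S"
    unfolding h_def J_def
    by (intro has_integral_neg has_integral_diff has_integral_add has_integral_mult_right integrable_integral ints)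
  then have h: "(h has_integral - ((b + 1) * z * (1 - z) * J 2 z + (c - (a + b + 1) * z) * J 1 z - a * J 0 z)) {0..1}"
    using has_integral_open_interval[of h _ 0 1] by simp
  note L2z = log_branch_on_parameter[OF z L2]
  have ftc: "(h has_integral ?B y - ?B x) {x..y}" if xy: "0 < x" "x < y" "y < 1" for x y
  proof -
    obtain X where X: "finite X" and C1: "\<gamma> C1_differentiable_on {x..y} - X"
      using contour xy unfolding open_contour_def piecewise_C1_differentiable_on_def by blast
    show ?thesis
    proof (rule fundamental_theorem_of_calculus_strong[OF X])
      have "continuous_on ?S ?B"
        unfolding boundary_term_def using L0 L1 L2z by (intro continuous_intros) (auto simp: log_branch_on_def)
      then show "continuous_on {x..y} ?B" using xy by (auto elim!: continuous_on_subset)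
      fix s assume s: "s \<in> {x..y} - X"
      then have sS: "s \<in> ?S" using xy by auto
      obtain D where D: "(\<gamma> has_vector_derivative D) (at s)"
        using C1 s unfolding C1_differentiable_on_def by blast
      have "v s = D" unfolding v_def using sS by (intro vector_derivative_at_within_ivl[OF D]) auto
      then show "(?B has_vector_derivative h s) (at s)"
        using boundary_term_derivative[where ?L2.0 = L2 and z = z, OF sS D L0 L1 L2z, of a b c] f[of z s] by (simp add: h_def)
    qed (use xy in auto)
  qed
  have "- ((b + 1) * z * (1 - z) * J 2 z + (c - (a + b + 1) * z) * J 1 z - a * J 0 z) = l1 - l0"
    using integral_eq_of_local_antiderivative[OF has_integral_integrable[OF h] ftc l0 l1] integral_unique[OF h] by simp
  moreover have dI: "deriv I w = b * J 1 w" if "w \<in> U" for w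
    unfolding I_eq using DERIV_imp_deriv[OF J'[OF that, of 0]] by simp
  moreover have "(deriv ^^ 2) I z = b * (b + 1) * J 2 z"
  proof -
    have "(deriv ^^ 2) I z = deriv (deriv I) z" by (simp add: numeral_2_eq_2)
    also have "\<dots> = deriv (\<lambda>w. b * J 1 w) z"
      using eventually_nhds_in_open[OF U z] dI by (intro deriv_cong_ev) (auto elim: eventually_mono)
    also have "\<dots> = b * ((b + 1) * J 2 z)"
      using DERIV_imp_deriv[OF DERIV_cmult[OF J'[OF z, of 1]]] by (simp add: numeral_2_eq_2)
    finally show ?thesis by (simp add: mult_ac)
  qed
  ultimately have "hypergeometric_op a b c I z = - b * - ((b + 1) * z * (1 - z) * J 2 z + (c - (a + b + 1) * z) * J 1 z - a * J 0 z)"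
    unfolding hypergeometric_op_def using z I_eq by (simp add: algebra_simps)
  with \<open>_ = l1 - l0\<close> show "hypergeometric_op a b c I z = - b * (l1 - l0)" by simp
qed

section \<open>Conditionally convergent integrals along regular contours\<close>

lemma hypergeometric_op_cong:
  assumes "open S" "z \<in> S" "\<And>w. w \<in> S \<Longrightarrow> f w = g w"
  shows "hypergeometric_op a b c f z = hypergeometric_op a b c g z"
proof -
  have ev: "\<forall>\<^sub>F w in nhds z. f w = g w"
    using eventually_nhds_in_open[OF assms(1,2)] by (rule eventually_mono) (rule assms(3))
  show ?thesis unfolding hypergeometric_op_def
    using higher_deriv_cong_ev[OF ev refl, of 2] deriv_cong_ev[OF ev refl] assms by simp
qed

lemma hypergeometric_op_add:
  assumes "open S" "z \<in> S" "f holomorphic_on S" "g holomorphic_on S"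
  shows "hypergeometric_op a b c (\<lambda>w. f w + g w) z = hypergeometric_op a b c f z + hypergeometric_op a b c g z"
  unfolding hypergeometric_op_def
  using higher_deriv_add[OF assms(3,4,1,2), of 2] higher_deriv_add[OF assms(3,4,1,2), of 1]
  by (simp add: algebra_simps)

definition euler_piece ::
    "complex \<Rightarrow> complex \<Rightarrow> complex \<Rightarrow> (real \<Rightarrow> complex) \<Rightarrow> (real \<Rightarrow> complex) \<Rightarrow> (real \<Rightarrow> complex) \<Rightarrow>
     (complex \<Rightarrow> real \<Rightarrow> complex) \<Rightarrow> real \<Rightarrow> real \<Rightarrow> complex \<Rightarrow> complex" where
  "euler_piece a b c \<gamma> L0 L1 L2 u v w =
     integral {u..v} (\<lambda>s. euler_integrand a b c L0 L1 L2 w s * vector_derivative \<gamma> (at s within {0..1}))"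

text \<open>
  The increment of the boundary term is expressed by one-sided limits, so that the pieces may touch
  the ends of the contour, where the branches are not determined. Integrability and holomorphy near
  \<open>z\<close> are included because they make the formula additive over adjacent pieces.
\<close>
definition boundary_formula_on ::
    "complex \<Rightarrow> complex \<Rightarrow> complex \<Rightarrow> (real \<Rightarrow> complex) \<Rightarrow> (real \<Rightarrow> complex) \<Rightarrow> (real \<Rightarrow> complex) \<Rightarrow>
     (complex \<Rightarrow> real \<Rightarrow> complex) \<Rightarrow> complex \<Rightarrow> real \<Rightarrow> real \<Rightarrow> bool" where
  "boundary_formula_on a b c \<gamma> L0 L1 L2 z u v \<longleftrightarrow>
    (\<exists>r>0.
      (\<forall>w\<in>ball z r. (\<lambda>s. euler_integrand a b c L0 L1 L2 w s * vector_derivative \<gamma> (at s within {0..1})) integrable_on {u..v}) \<and>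
      euler_piece a b c \<gamma> L0 L1 L2 u v holomorphic_on ball z r \<and>
      (\<forall>l0 l1. (boundary_term a b c L0 L1 L2 z \<longlongrightarrow> l0) (at_right u) \<longrightarrow>
        (boundary_term a b c L0 L1 L2 z \<longlongrightarrow> l1) (at_left v) \<longrightarrow>
        hypergeometric_op a b c (euler_piece a b c \<gamma> L0 L1 L2 u v) z = - b * (l1 - l0)))"

text \<open>
  Both sides of the formula are additive; the boundary values at the common point cancel because the
  boundary term is continuous there.
\<close>
lemma boundary_formula_on_join:
  assumes um: "boundary_formula_on a b c \<gamma> L0 L1 L2 z u m" and mv: "boundary_formula_on a b c \<gamma> L0 L1 L2 z m v"
    and ord: "u < m" "m < v" and cont: "isCont (boundary_term a b c L0 L1 L2 z) m"
  shows "boundary_formula_on a b c \<gamma> L0 L1 L2 z u v"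
proof -
  let ?F = "\<lambda>w s. euler_integrand a b c L0 L1 L2 w s * vector_derivative \<gamma> (at s within {0..1})"
  let ?I = "euler_piece a b c \<gamma> L0 L1 L2"
  let ?B = "boundary_term a b c L0 L1 L2 z"
  let ?H = "hypergeometric_op a b c"
  obtain r1 where r1: "r1 > 0" "\<And>w. w \<in> ball z r1 \<Longrightarrow> ?F w integrable_on {u..m}"
      "?I u m holomorphic_on ball z r1"
      "\<And>l0 l1. (?B \<longlongrightarrow> l0) (at_right u) \<Longrightarrow> (?B \<longlongrightarrow> l1) (at_left m) \<Longrightarrow> ?H (?I u m) z = - b * (l1 - l0)"
    using um unfolding boundary_formula_on_def by blast
  obtain r2 where r2: "r2 > 0" "\<And>w. w \<in> ball z r2 \<Longrightarrow> ?F w integrable_on {m..v}"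
      "?I m v holomorphic_on ball z r2"
      "\<And>l0 l1. (?B \<longlongrightarrow> l0) (at_right m) \<Longrightarrow> (?B \<longlongrightarrow> l1) (at_left v) \<Longrightarrow> ?H (?I m v) z = - b * (l1 - l0)"
    using mv unfolding boundary_formula_on_def by blast
  define r where "r = min r1 r2"
  have r: "r > 0" "ball z r \<subseteq> ball z r1" "ball z r \<subseteq> ball z r2"
    using r1 r2 by (auto simp: r_def)
  have hol: "?I u m holomorphic_on ball z r" "?I m v holomorphic_on ball z r"
    using r1(3) r2(3) r holomorphic_on_subset by blast+
  have int: "?F w integrable_on {u..v}" if "w \<in> ball z r" for w
    using that r r1(2) r2(2) ord
    by (intro Henstock_Kurzweil_Integration.integrable_combine[of u m v]) auto
  have split: "?I u m w + ?I m v w = ?I u v w" if "w \<in> ball z r" for w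
    unfolding euler_piece_def using ord int[OF that]
    by (intro Henstock_Kurzweil_Integration.integral_combine) auto
  have "?I u v holomorphic_on ball z r"
    by (rule holomorphic_transform[OF holomorphic_on_add[OF hol] split])
  moreover have "?H (?I u v) z = - b * (l1 - l0)"
    if "(?B \<longlongrightarrow> l0) (at_right u)" "(?B \<longlongrightarrow> l1) (at_left v)" for l0 l1
  proof -
    have lims: "(?B \<longlongrightarrow> ?B m) (at_left m)" "(?B \<longlongrightarrow> ?B m) (at_right m)"
      using cont by (auto simp: isCont_def filterlim_at_split)
    have "?H (?I u m) z + ?H (?I m v) z = - b * (l1 - l0)"
      unfolding r1(4)[OF that(1) lims(1)] r2(4)[OF lims(2) that(2)] by (simp add: algebra_simps)
    moreover have "?H (?I u v) z = ?H (\<lambda>w. ?I u m w + ?I m v w) z"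
      using r split by (intro hypergeometric_op_cong[of "ball z r"]) auto
    ultimately show ?thesis
      using hypergeometric_op_add[OF open_ball _ hol, of z] r by simp
  qed
  ultimately show ?thesis unfolding boundary_formula_on_def using r(1) int by blast
qed

text \<open>
  A short arc stays in a disc on which all three branches extend holomorphically, also in the
  parameter. There the integrand has a primitive, so the arc may be replaced by the segment between
  its end points without changing the integral or the boundary values. On the segment the integrand
  is continuous, and the absolutely convergent case applies.
\<close>
lemma boundary_formula_on_near_point:
  assumes vp: "valid_path \<gamma>"
    and x: "x \<in> {0..1}" and avoid: "\<gamma> x \<noteq> 0" "\<gamma> x \<noteq> 1" "\<gamma> x \<noteq> z"
    and U: "open U" "z \<in> U"
    and L0: "log_branch_on {0<..<1} L0 \<gamma>"
    and L1: "log_branch_on {0<..<1} L1 (\<lambda>s. 1 - \<gamma> s)"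
    and L2: "log_branch_on (U \<times> {0<..<1}) (\<lambda>(w, s). L2 w s) (\<lambda>(w, s). \<gamma> s - w)"
  shows "\<exists>d>0. \<forall>u v. u \<le> x \<and> x \<le> v \<and> v - u < d \<longrightarrow> 0 \<le> u \<and> u < v \<and> v \<le> 1 \<longrightarrow>
    boundary_formula_on a b c \<gamma> L0 L1 L2 z u v"
proof -
  let ?t0 = "\<gamma> x"
  obtain e where e: "e > 0" "ball z e \<subseteq> U" using U openE by blast
  \<comment> \<open>Small enough that \<open>t\<close>, \<open>1 - t\<close> and \<open>t - w\<close> stay in discs around their central values that
    miss the origin; \<open>t\<close> and \<open>w\<close> both move in \<open>t - w\<close>, hence the factor 2.\<close>
  define \<rho> where "\<rho> = Min {e, norm ?t0, norm (1 - ?t0), norm (?t0 - z) / 2}"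
  have \<rho>: "\<rho> > 0" "\<rho> \<le> e" "\<rho> \<le> norm ?t0" "\<rho> \<le> norm (1 - ?t0)" "2 * \<rho> \<le> norm (?t0 - z)"
    using e avoid by (auto simp: \<rho>_def min_def)
  let ?N = "ball ?t0 \<rho>" and ?W = "ball z \<rho>"
  have WU: "?W \<subseteq> U" using \<rho> e by auto
  have near0: "norm (t - ?t0) < norm ?t0" if "t \<in> ?N" for t
    using that \<rho> by (simp add: dist_norm norm_minus_commute)
  have near1: "norm ((1 - t) - (1 - ?t0)) < norm (1 - ?t0)" if "t \<in> ?N" for t
    using that \<rho> by (simp add: dist_norm)
  have near2: "norm ((t - w) - (?t0 - z)) < norm (?t0 - z)" if "t \<in> ?N" "w \<in> ?W" for t w
  proof -
    have "norm ((t - ?t0) - (w - z)) \<le> norm (t - ?t0) + norm (w - z)" by (rule norm_triangle_ineq4)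
    also have "\<dots> < 2 * \<rho>" using that by (simp add: dist_norm norm_minus_commute)
    finally show ?thesis using \<rho> by (simp add: algebra_simps)
  qed
  have cont: "continuous_on {0..1} \<gamma>"
    using vp by (simp add: valid_path_def piecewise_C1_differentiable_on_def)
  obtain d where d: "d > 0" "\<And>s. s \<in> {0..1} \<Longrightarrow> dist s x < d \<Longrightarrow> \<gamma> s \<in> ?N"
    using cont x \<rho>(1) unfolding continuous_on_iff by (metis dist_commute mem_ball)
  have "boundary_formula_on a b c \<gamma> L0 L1 L2 z u v"
    if uv: "u \<le> x" "x \<le> v" "v - u < d" "0 \<le> u" "u < v" "v \<le> 1" for u v
  proof -
    have N: "\<gamma> ` {u..v} \<subseteq> ?N" using d(2) uv by (auto simp: dist_real_def)
    then have N': "\<gamma> s \<in> ?N" if "s \<in> {u..v}" for s using that by blast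
    let ?S = "{u<..<v}"
    have S: "connected ?S" "?S \<noteq> {}" "?S \<subseteq> {0<..<1}" "?S \<subseteq> {u..v}" using uv by auto
    have cont_uv: "continuous_on {u..v} \<gamma>" using cont uv by (auto elim: continuous_on_subset)

    \<comment> \<open>On the piece, each given branch is a principal logarithm around the centre plus a constant.
      The constants are read off on the open interval, since the branches carry no information at
      the end points of the whole contour.\<close>
    obtain k0 where k0: "exp k0 = ?t0" "\<And>s. s \<in> ?S \<Longrightarrow> L0 s = k0 + Ln (\<gamma> s / ?t0)"
    proof (rule log_branch_on_near_unique[OF S(1,2), of L0 \<gamma> ?t0])
      show "log_branch_on ?S L0 \<gamma>"
        using L0 S(3) by (auto simp: log_branch_on_def elim: continuous_on_subset)
    qed (use near0 N' S(4) in auto)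
    obtain k1 where k1: "exp k1 = 1 - ?t0" "\<And>s. s \<in> ?S \<Longrightarrow> L1 s = k1 + Ln ((1 - \<gamma> s) / (1 - ?t0))"
    proof (rule log_branch_on_near_unique[OF S(1,2), of L1 "\<lambda>s. 1 - \<gamma> s" "1 - ?t0"])
      show "log_branch_on ?S L1 (\<lambda>s. 1 - \<gamma> s)"
        using L1 S(3) by (auto simp: log_branch_on_def elim: continuous_on_subset)
    qed (use near1 N' S(4) in auto)
    obtain k2 where k2: "exp k2 = ?t0 - z"
      "\<And>y. y \<in> ?W \<times> ?S \<Longrightarrow> (\<lambda>(w, s). L2 w s) y = k2 + Ln ((\<lambda>(w, s). \<gamma> s - w) y / (?t0 - z))"
    proof (rule log_branch_on_near_unique[of "?W \<times> ?S" "\<lambda>(w, s). L2 w s" "\<lambda>(w, s). \<gamma> s - w" "?t0 - z"])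
      show "log_branch_on (?W \<times> ?S) (\<lambda>(w, s). L2 w s) (\<lambda>(w, s). \<gamma> s - w)"
      proof -
        have "?W \<times> ?S \<subseteq> U \<times> {0<..<1}" using WU S(3) by auto
        then show ?thesis using L2 unfolding log_branch_on_def by (meson continuous_on_subset subsetD)
      qed
      show "connected (?W \<times> ?S)" using S by (intro connected_Times) auto
      show "?W \<times> ?S \<noteq> {}" using S(2) \<rho>(1) by auto
    qed (use near2 N' S(4) in auto)

    define \<l>0 where "\<l>0 t = k0 + Ln (t / ?t0)" for t
    define \<l>1 where "\<l>1 t = k1 + Ln ((1 - t) / (1 - ?t0))" for t
    define \<l>2 where "\<l>2 w t = k2 + Ln ((t - w) / (?t0 - z))" for w t
    define G where "G w t = exp ((b - c) * \<l>0 t) * exp ((c - a - 1) * \<l>1 t) * exp (- b * \<l>2 w t)" for w t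
    define Gb where "Gb t = exp ((b - c + 1) * \<l>0 t) * exp ((c - a) * \<l>1 t) * exp ((- b - 1) * \<l>2 z t)" for t
    have hol_l: "\<l>0 holomorphic_on ?N" "\<l>1 holomorphic_on ?N"
      and hol_l2: "\<And>w. w \<in> ?W \<Longrightarrow> \<l>2 w holomorphic_on ?N"
      unfolding \<l>0_def \<l>1_def \<l>2_def
      using avoid near0 near1 near2
      by (intro holomorphic_intros; simp add: quotient_notin_nonpos_Reals_of_near)+
    have hol_G: "G w holomorphic_on ?N" if "w \<in> ?W" for w
      unfolding G_def by (intro holomorphic_intros hol_l hol_l2 that)
    have cont_Gb: "continuous_on ?N Gb"
      unfolding Gb_def using \<rho>(1)
      by (intro holomorphic_on_imp_continuous_on holomorphic_intros hol_l hol_l2) auto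
    have int_\<gamma>: "euler_integrand a b c L0 L1 L2 w s = G w (\<gamma> s)" if "w \<in> ?W" "s \<in> ?S" for w s
      using k0(2) k1(2) k2(2)[of "(w, s)"] that by (simp add: euler_integrand_def G_def \<l>0_def \<l>1_def \<l>2_def)
    have bt_\<gamma>: "boundary_term a b c L0 L1 L2 z s = Gb (\<gamma> s)" if "s \<in> ?S" for s
      using k0(2) k1(2) k2(2)[of "(z, s)"] that \<rho>(1) by (simp add: boundary_term_def Gb_def \<l>0_def \<l>1_def \<l>2_def)

    \<comment> \<open>The segment with the same end points, carrying the same branches.\<close>
    define p where "p = linepath (\<gamma> u) (\<gamma> v)"
    define M0 where "M0 = (\<lambda>s. \<l>0 (p s))"
    define M1 where "M1 = (\<lambda>s. \<l>1 (p s))"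
    define M2 where "M2 = (\<lambda>w s. \<l>2 w (p s))"
    have pN: "p s \<in> ?N" if "s \<in> {0..1}" for s
    proof -
      have "path_image p \<subseteq> ?N" unfolding p_def path_image_linepath
        using N' uv by (intro closed_segment_subset) auto
      then show ?thesis using that unfolding path_image_def by blast
    qed
    have p_vp: "valid_path p" by (simp add: p_def)
    have p_cont: "continuous_on A p" for A unfolding p_def by (rule continuous_on_linepath)
    have int_p: "euler_integrand a b c M0 M1 M2 w s = G w (p s)" for w s
      by (simp add: euler_integrand_def G_def M0_def M1_def M2_def)
    have bt_p: "boundary_term a b c M0 M1 M2 z s = Gb (p s)" for s
      by (simp add: boundary_term_def Gb_def M0_def M1_def M2_def)

    have M0: "log_branch_on {0<..<1} M0 p"
      unfolding M0_def \<l>0_def using near0 pN by (intro log_branch_on_near p_cont k0) auto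
    have M1: "log_branch_on {0<..<1} M1 (\<lambda>s. 1 - p s)"
      unfolding M1_def \<l>1_def using near1 pN by (intro log_branch_on_near continuous_intros p_cont k1) auto
    have M2: "log_branch_on (?W \<times> {0<..<1}) (\<lambda>(w, s). M2 w s) (\<lambda>(w, s). p s - w)"
    proof -
      have "log_branch_on (?W \<times> {0<..<1}) (\<lambda>y. k2 + Ln ((p (snd y) - fst y) / (?t0 - z))) (\<lambda>y. p (snd y) - fst y)"
        using near2 pN by (intro log_branch_on_near continuous_intros k2 continuous_on_compose2[OF p_cont[of UNIV]]) auto
      then show ?thesis by (simp add: M2_def \<l>2_def case_prod_unfold)
    qed
    have p_avoids: "p ` {0<..<1} \<inter> ?W = {}"
    proof -
      have "p s \<noteq> w" if "s \<in> {0<..<1}" "w \<in> ?W" for s w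
        using near2[of "p s" w] pN[of s] that by (auto simp: norm_minus_commute)
      then show ?thesis by blast
    qed
    have p_abs: "\<forall>w\<in>?W. abs_integrable_along p (euler_integrand a b c M0 M1 M2 w)"
    proof
      fix w assume w: "w \<in> ?W"
      have "continuous_on {0..1} (\<lambda>s. G w (p s))"
        by (rule continuous_on_compose2[OF holomorphic_on_imp_continuous_on[OF hol_G[OF w]] p_cont]) (use pN in blast)
      then have "continuous_on {0..1} (\<lambda>s. G w (p s) * (\<gamma> v - \<gamma> u))" by (intro continuous_intros)
      from absolutely_integrable_continuous_real[OF this]
      show "abs_integrable_along p (euler_integrand a b c M0 M1 M2 w)" unfolding abs_integrable_along_def int_p
        by (rule absolutely_integrable_spike[where S = "{}"])
          (auto simp: p_def vector_derivative_linepath_within)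
    qed
    note line = euler_integral_abs_convergent[OF open_contour_valid_path[OF p_vp] open_ball p_avoids M0 M1 M2 p_abs]
    define I where "I = (\<lambda>w. integral_along p (euler_integrand a b c M0 M1 M2 w))"

    have int: "((\<lambda>s. euler_integrand a b c L0 L1 L2 w s * vector_derivative \<gamma> (at s within {0..1})) has_integral I w) {u..v}"
      if w: "w \<in> ?W" for w
    proof -
      obtain H where "\<And>t. t \<in> ?N \<Longrightarrow> (H has_field_derivative G w t) (at t within ?N)"
        using holomorphic_convex_primitive'[OF convex_ball open_ball hol_G[OF w]] by blast
      then have H: "(H has_field_derivative G w t) (at t)" if "t \<in> ?N" for t
        using that by (metis at_within_open open_ball)
      have "\<gamma> piecewise_C1_differentiable_on {u..v}"
        using vp uv by (auto simp: valid_path_def elim!: piecewise_C1_differentiable_on_subset)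
      then have "((\<lambda>s. G w (\<gamma> s) * vector_derivative \<gamma> (at s within {0..1})) has_integral H (\<gamma> v) - H (\<gamma> u)) {u..v}"
        using N H uv by (intro has_integral_along_piece_of_primitive[of _ _ _ ?N]) auto
      then have *: "((\<lambda>s. euler_integrand a b c L0 L1 L2 w s * vector_derivative \<gamma> (at s within {0..1})) has_integral
          H (\<gamma> v) - H (\<gamma> u)) {u..v}"
        using has_integral_spike_interior[of "\<lambda>s. G w (\<gamma> s) * vector_derivative \<gamma> (at s within {0..1})" _ u v
            "\<lambda>s. euler_integrand a b c L0 L1 L2 w s * vector_derivative \<gamma> (at s within {0..1})"] int_\<gamma>[OF w]
        by simp
      have "((\<lambda>s. G w (p s) * vector_derivative p (at s within {0..1})) has_integral H (p 1) - H (p 0)) {0..1}"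
        using p_vp pN H by (intro has_integral_along_piece_of_primitive[of _ _ _ ?N]) (auto simp: valid_path_def)
      \<comment> \<open>The same primitive computes the integral along the segment.\<close>
      then have "I w = H (\<gamma> v) - H (\<gamma> u)"
        unfolding I_def integral_along_def int_p by (simp add: integral_unique p_def linepath_0' linepath_1')
      with * show ?thesis by simp
    qed
    have piece: "I w = euler_piece a b c \<gamma> L0 L1 L2 u v w" if "w \<in> ?W" for w
      unfolding euler_piece_def using integral_unique[OF int[OF that]] by simp
    have hol: "euler_piece a b c \<gamma> L0 L1 L2 u v holomorphic_on ?W"
      using line(1) piece unfolding I_def by (rule holomorphic_transform)
    have "hypergeometric_op a b c (euler_piece a b c \<gamma> L0 L1 L2 u v) z = - b * (l1 - l0)"
      if l0: "(boundary_term a b c L0 L1 L2 z \<longlongrightarrow> l0) (at_right u)"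
        and l1: "(boundary_term a b c L0 L1 L2 z \<longlongrightarrow> l1) (at_left v)" for l0 l1
    proof -
      have "continuous_on {u..v} (\<lambda>s. Gb (\<gamma> s))"
        by (rule continuous_on_compose2[OF cont_Gb cont_uv N])
      from continuous_on_Icc_at_rightD[OF this uv(5)] continuous_on_Icc_at_leftD[OF this uv(5)]
      have "(boundary_term a b c L0 L1 L2 z \<longlongrightarrow> Gb (\<gamma> u)) (at_right u)"
        "(boundary_term a b c L0 L1 L2 z \<longlongrightarrow> Gb (\<gamma> v)) (at_left v)"
        using eventually_at_right_real[OF uv(5)] eventually_at_left_real[OF uv(5)] bt_\<gamma>
        by (auto elim!: Lim_transform_eventually elim: eventually_mono)
      \<comment> \<open>Arc and segment therefore have the same boundary values.\<close>
      with l0 l1 have l: "l0 = Gb (\<gamma> u)" "l1 = Gb (\<gamma> v)"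
        using tendsto_unique trivial_limit_at_right_real trivial_limit_at_left_real by blast+
      have "continuous_on {0..1} (\<lambda>s. Gb (p s))"
        by (rule continuous_on_compose2[OF cont_Gb p_cont]) (use pN in blast)
      from continuous_on_Icc_at_rightD[OF this] continuous_on_Icc_at_leftD[OF this]
      have "((\<lambda>s. Gb (p s)) \<longlongrightarrow> l0) (at_right 0)" "((\<lambda>s. Gb (p s)) \<longlongrightarrow> l1) (at_left 1)"
        by (simp_all add: p_def linepath_0' linepath_1' l)
      then have "hypergeometric_op a b c I z = - b * (l1 - l0)"
        unfolding I_def using \<rho>(1) by (intro line(2)) (auto simp: bt_p[abs_def])
      then show ?thesis
        using hypergeometric_op_cong[of ?W z I "euler_piece a b c \<gamma> L0 L1 L2 u v" a b c] piece \<rho>(1) by simp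
    qed
    then show ?thesis
      unfolding boundary_formula_on_def using \<rho>(1) hol int by blast
  qed
  then show ?thesis using d(1) by blast
qed

section \<open>The hypergeometric equation\<close>

theorem theorem3p1:
  fixes a b c z :: complex
    and \<gamma> L0 L1 :: "real \<Rightarrow> complex"
    and L2 :: "complex \<Rightarrow> real \<Rightarrow> complex"
    and U :: "complex set"
  assumes contour: "open_contour \<gamma>"
    and open_U: "open U" and avoids: "\<gamma> ` {0<..<1} \<inter> U = {}"
    and log_t: "log_branch_on {0<..<1} L0 \<gamma>"
    and log_1_minus_t: "log_branch_on {0<..<1} L1 (\<lambda>s. 1 - \<gamma> s)"
    and log_t_minus_z:
      "log_branch_on (U \<times> {0<..<1}) (\<lambda>(w, s). L2 w s) (\<lambda>(w, s). \<gamma> s - w)"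
    and regular_or_convergent:
      "(valid_path \<gamma> \<and> path_image \<gamma> \<inter> {0, 1} = {}) \<or>
       (\<forall>w\<in>U. abs_integrable_along \<gamma> (euler_integrand a b c L0 L1 L2 w))"
    and z: "z \<in> U"
    and boundary: "endpoint_difference_vanishes (boundary_term a b c L0 L1 L2 z)"
  shows "(\<lambda>w. integral_along \<gamma> (euler_integrand a b c L0 L1 L2 w)) holomorphic_on U \<and>
         hypergeometric_op a b c
           (\<lambda>w. integral_along \<gamma> (euler_integrand a b c L0 L1 L2 w)) z = 0"
proof -
  let ?I = "\<lambda>w. integral_along \<gamma> (euler_integrand a b c L0 L1 L2 w)"
  obtain l0 l1 where lim: "(boundary_term a b c L0 L1 L2 z \<longlongrightarrow> l0) (at_right 0)"
      "(boundary_term a b c L0 L1 L2 z \<longlongrightarrow> l1) (at_left 1)" and l: "l1 - l0 = 0"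
    using boundary unfolding endpoint_difference_vanishes_def by blast
  show ?thesis
  proof (cases "\<forall>w\<in>U. abs_integrable_along \<gamma> (euler_integrand a b c L0 L1 L2 w)")
    case True
    note conv = euler_integral_abs_convergent[OF contour open_U avoids log_t log_1_minus_t log_t_minus_z True]
    show ?thesis using conv(1) conv(2)[OF z lim] l by simp
  next
    case False
    with regular_or_convergent have vp: "valid_path \<gamma>" and reg: "path_image \<gamma> \<inter> {0, 1} = {}" by auto
    have cont: "continuous_on {0..1} \<gamma>"
      using vp by (simp add: valid_path_def piecewise_C1_differentiable_on_def)
    have avoids_closed: "\<gamma> x \<notin> U" if "x \<in> {0..1}" for x
    proof -
      have "\<gamma> ` closure {0<..<1} \<subseteq> - U"
        using cont open_U avoids by (intro image_closure_subset) auto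
      then have "\<gamma> ` {0..1} \<subseteq> - U" by simp
      then show ?thesis using that by blast
    qed
    have I: "?I = euler_piece a b c \<gamma> L0 L1 L2 0 1"
      by (simp add: fun_eq_iff integral_along_def euler_piece_def)
    have formula: "boundary_formula_on a b c \<gamma> L0 L1 L2 w 0 1" if w: "w \<in> U" for w
    proof -
      \<comment> \<open>The bisection principle also ranges over empty and degenerate intervals, for which nothing is
        claimed.\<close>
      define P where "P u v \<longleftrightarrow> (0 \<le> u \<and> u < v \<and> v \<le> 1 \<longrightarrow> boundary_formula_on a b c \<gamma> L0 L1 L2 w u v)" for u v
      have "P 0 1"
        using zero_le_one[where 'a = real]
      proof (induction rule: Bolzano[where P = P])
        case (trans u m v)
        show ?case
        proof (cases "u = m \<or> m = v")
          case True
          then show ?thesis using trans(1,2) by auto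
        next
          case False
          show ?thesis
            unfolding P_def
          proof
            assume "0 \<le> u \<and> u < v \<and> v \<le> 1"
            with False trans have ord: "u < m" "m < v" "0 < m" "m < 1" "0 \<le> u" "v \<le> 1" by auto
            have "continuous_on {0<..<1} (boundary_term a b c L0 L1 L2 w)"
              unfolding boundary_term_def using log_t log_1_minus_t log_branch_on_parameter[OF w log_t_minus_z]
              by (intro continuous_intros) (auto simp: log_branch_on_def)
            then have "isCont (boundary_term a b c L0 L1 L2 w) m"
              using ord by (simp add: continuous_on_eq_continuous_at)
            then show "boundary_formula_on a b c \<gamma> L0 L1 L2 w u v"
              using trans(1,2) ord by (intro boundary_formula_on_join[of _ _ _ _ _ _ _ _ u m v]) (auto simp: P_def)
          qed
        qed
      next
        case (local x)
        then have x: "x \<in> {0..1}" by simp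
        have "\<gamma> x \<in> path_image \<gamma>" using x by (auto simp: path_image_def)
        with reg have "\<gamma> x \<noteq> 0" "\<gamma> x \<noteq> 1" by auto
        moreover have "\<gamma> x \<noteq> w" using avoids_closed[OF x] w by auto
        ultimately show ?case
          unfolding P_def
          by (rule boundary_formula_on_near_point[OF vp x _ _ _ open_U w log_t log_1_minus_t log_t_minus_z])
      qed
      then show ?thesis by (simp add: P_def)
    qed
    have "?I field_differentiable at w" if w: "w \<in> U" for w
    proof -
      obtain r where "r > 0" "?I holomorphic_on ball w r"
        using formula[OF w] unfolding boundary_formula_on_def I by blast
      then show ?thesis by (metis centre_in_ball holomorphic_on_imp_differentiable_at open_ball)
    qed
    then have "?I holomorphic_on U"
      using field_differentiable_at_within holomorphic_on_def by blast
    moreover have "hypergeometric_op a b c ?I z = - b * (l1 - l0)"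
      using formula[OF z] lim unfolding boundary_formula_on_def I by blast
    ultimately show ?thesis using l by simp
  qed
qed

end
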